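(* Let $\alpha,\beta,\gamma\in[0,1]$ with $\alpha<\beta\le\gamma\le\min\{1,\alpha+\beta\}$. Then there exist $A,B\subseteq\mathbb{Z}^+$ such that $\mathrm{Dim}_\zeta(A)=\alpha$, $\mathrm{Dim}_\zeta(B)=\beta$, and $\mathrm{Dim}_\zeta(A+B)=\gamma$.
   Context: For $A\subseteq\mathbb{Z}^+$, $\mathrm{Dim}_\zeta(A)=\inf\{s\ge0\mid\sum_{n\in A}n^{-s}<\infty\}$. For $A,B\subseteq\mathbb{Z}^+$, $A+B=\{a+b\mid a\in A,b\in B\}$. *)

theory Defs
  imports "HOL-Analysis.Analysis" "HOL-Library.Set_Algebras"
begin

text \<open>
  The infimum is taken in the reals: the set of admissible exponents is bounded below by 0,
  and it is nonempty for every \<open>A\<close>, since each \<open>s > 1\<close> belongs to it. Intended for sets \<open>A\<close>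
  of positive integers.
\<close>

definition dim_zeta :: "nat set \<Rightarrow> real" where
  "dim_zeta A = Inf {s. 0 \<le> s \<and> (\<lambda>n. real n powr (- s)) summable_on A}"

end

theory Submission
  imports Defs "HOL-Real_Asymp.Real_Asymp"
begin

text \<open>
  Fix scales so sparse that the scale preceding \<open>M\<close> is \<open>M powr o(1)\<close>. At scale \<open>M\<close>
  let \<open>B\<close> contain an interval of about \<open>M powr \<beta>\<close> integers starting at \<open>M\<close>, and let \<open>A\<close> contain
  an arithmetic progression starting at \<open>M\<close> with about \<open>M powr \<alpha>\<close> terms and common difference
  about \<open>M powr (\<gamma> - \<alpha>)\<close>. As \<open>\<gamma> - \<alpha> \<le> \<beta>\<close>, the sum of the two blocks is an interval of about
  \<open>M powr \<gamma>\<close> integers. Sums of blocks of different scales contribute at most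
  \<open>M powr (\<beta> + o(1))\<close> elements, which is negligible because \<open>\<beta> \<le> \<gamma>\<close>.
\<close>

section \<open>Zeta dimension from finite blocks\<close>

lemma dim_zeta_eqI:
  assumes "0 \<le> g"
    and up: "\<And>s. g < s \<Longrightarrow> (\<lambda>n. real n powr (- s)) summable_on A"
    and lo: "\<And>s. 0 \<le> s \<Longrightarrow> s < g \<Longrightarrow> \<not> (\<lambda>n. real n powr (- s)) summable_on A"
  shows "dim_zeta A = g"
proof (rule antisym)
  let ?S = "{s. 0 \<le> s \<and> (\<lambda>n. real n powr (- s)) summable_on A}"
  have mem: "s \<in> ?S" if "g < s" for s
    using that up assms(1) by simp
  have bdd: "bdd_below ?S"
    by (rule bdd_belowI[of _ 0]) simp
  show "dim_zeta A \<le> g"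
  proof (rule field_le_epsilon)
    fix e :: real assume "0 < e"
    then show "dim_zeta A \<le> g + e"
      unfolding dim_zeta_def by (intro cInf_lower mem bdd) simp
  qed
  have "?S \<noteq> {}"
    using mem[of "g + 1"] by auto
  then show "g \<le> dim_zeta A"
    unfolding dim_zeta_def by (rule cInf_greatest) (use lo in force)
qed

text \<open>A finite subset of the union already lies in finitely many of the \<open>S k\<close>.
  Overlaps among these are harmless, as counting an element repeatedly only enlarges the sum of the
  block sums.\<close>

lemma summable_on_UN_nonneg:
  fixes f :: "'a \<Rightarrow> real" and S :: "nat \<Rightarrow> 'a set"
  assumes fin: "\<And>k. finite (S k)" and nonneg: "\<And>x. 0 \<le> f x"
    and summ: "summable (\<lambda>k. \<Sum>x\<in>S k. f x)"
  shows "f summable_on (\<Union>k. S k)"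
proof (rule nonneg_bdd_above_summable_on)
  have partial: "sum f (\<Union>k<m. S k) \<le> (\<Sum>k<m. \<Sum>x\<in>S k. f x)" for m
  proof (induction m)
    case (Suc m)
    have "sum f (\<Union>k<Suc m. S k) = sum f (S m \<union> (\<Union>k<m. S k))"
      by (simp add: lessThan_Suc)
    also have "\<dots> \<le> sum f (S m) + sum f (\<Union>k<m. S k)"
      by (subst sum_Un) (auto simp: fin intro: sum_nonneg nonneg)
    finally show ?case
      using Suc by simp
  qed simp
  show "bdd_above (sum f ` {F. F \<subseteq> (\<Union>k. S k) \<and> finite F})"
  proof (rule bdd_aboveI2)
    fix F assume "F \<in> {F. F \<subseteq> (\<Union>k. S k) \<and> finite F}"
    then have F: "F \<subseteq> (\<Union>k. S k)" "finite F"
      by auto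
    have "\<forall>x\<in>F. \<exists>k. x \<in> S k"
      using F by auto
    then obtain k where k: "\<And>x. x \<in> F \<Longrightarrow> x \<in> S (k x)"
      by metis
    obtain m where "\<forall>i\<in>k ` F. i < m"
      using F(2) finite_nat_set_iff_bounded by blast
    then have "F \<subseteq> (\<Union>k<m. S k)"
      using k by blast
    then have "sum f F \<le> sum f (\<Union>k<m. S k)"
      by (intro sum_mono2) (auto simp: fin nonneg)
    also have "\<dots> \<le> (\<Sum>k<m. \<Sum>x\<in>S k. f x)"
      by (rule partial)
    also have "\<dots> \<le> (\<Sum>k. \<Sum>x\<in>S k. f x)"
      by (intro sum_le_suminf summ) (auto intro: sum_nonneg nonneg)
    finally show "sum f F \<le> (\<Sum>k. \<Sum>x\<in>S k. f x)" .
  qed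
qed (rule nonneg)

text \<open>A block of at least \<open>M k powr g / 4\<close> integers, each at most
  \<open>4 * M k\<close>, has sum at least a constant times \<open>M k powr (g - s)\<close>. This is
  unbounded in \<open>k\<close>, whereas a convergent sum bounds all its finite subsums.\<close>

lemma not_summable_on_zeta:
  fixes S :: "nat \<Rightarrow> nat set" and M :: "nat \<Rightarrow> nat"
  assumes M: "filterlim M at_top sequentially"
    and sub: "\<And>k. S k \<subseteq> A" and range: "\<And>k. S k \<subseteq> {1..4 * M k}"
    and card: "\<And>k. real (M k) powr g \<le> 4 * card (S k)"
    and s: "0 \<le> s" "s < g"
  shows "\<not> (\<lambda>n. real n powr (- s)) summable_on A"
proof
  let ?f = "\<lambda>n. real n powr (- s)"
  assume summ: "?f summable_on A"
  have le: "4 powr (- 1 - s) * real (M k) powr (g - s) \<le> infsum ?f A" for k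
  proof -
    have fin: "finite (S k)"
      by (rule finite_subset[OF range]) simp
    have "4 powr (- 1 - s) * real (M k) powr (g - s)
        = (real (M k) powr g / 4) * (4 * real (M k)) powr (- s)"
      by (simp add: powr_mult powr_diff powr_minus divide_simps)
    also have "\<dots> \<le> real (card (S k)) * real (4 * M k) powr (- s)"
      using card[of k] by (intro mult_mono) auto
    also have "\<dots> = (\<Sum>n\<in>S k. real (4 * M k) powr (- s))"
      by simp
    also have "\<dots> \<le> sum ?f (S k)"
    proof (rule sum_mono)
      fix n assume "n \<in> S k"
      then have "1 \<le> n" "n \<le> 4 * M k"
        using range[of k] by auto
      then show "real (4 * M k) powr (- s) \<le> ?f n"
        using s by (intro powr_mono2') (auto simp del: of_nat_mult)
    qed
    also have "\<dots> \<le> infsum ?f A"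
      by (rule finite_sum_le_infsum[OF summ fin sub]) simp
    finally show ?thesis .
  qed
  have "filterlim (\<lambda>k. real (M k)) at_top sequentially"
    by (rule filterlim_compose[OF filterlim_real_sequentially M])
  moreover have "filterlim (\<lambda>x :: real. x powr (g - s)) at_top at_top"
    using s by real_asymp
  ultimately have "filterlim (\<lambda>k. real (M k) powr (g - s)) at_top sequentially"
    by (rule filterlim_compose[rotated])
  then have "filterlim (\<lambda>k. 4 powr (- 1 - s) * real (M k) powr (g - s)) at_top sequentially"
    by (rule filterlim_tendsto_pos_mult_at_top[OF tendsto_const, rotated]) simp
  then have "\<forall>\<^sub>F k in sequentially. infsum ?f A < 4 powr (- 1 - s) * real (M k) powr (g - s)"
    by (rule filterlim_at_top_dense[THEN iffD1, rule_format])
  then obtain k where "infsum ?f A < 4 powr (- 1 - s) * real (M k) powr (g - s)"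
    by (auto simp: eventually_sequentially)
  with le[of k] show False
    by simp
qed

section \<open>Factorial scales\<close>

text \<open>The factorial exponent gives
  \<open>pow_fact k = pow_fact (Suc k) powr (1 / Suc k)\<close>, so a factor
  \<open>pow_fact k\<close> costs only o(1) in the exponent at the next scale.\<close>

definition pow_fact :: "nat \<Rightarrow> nat" where
  "pow_fact k = 2 ^ fact k"

lemma pow_fact_pos [simp]: "0 < pow_fact k"
  by (simp add: pow_fact_def)

lemma pow_fact_ge_1: "1 \<le> pow_fact k"
  using pow_fact_pos[of k] by linarith

lemma pow_fact_mono: "i \<le> j \<Longrightarrow> pow_fact i \<le> pow_fact j"
  by (simp add: pow_fact_def fact_mono power_increasing)

lemma pow_fact_at_top: "filterlim (\<lambda>k. pow_fact (Suc k)) at_top sequentially"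
proof (rule filterlim_at_top_mono[OF filterlim_ident])
  have "k \<le> pow_fact (Suc k)" for k
    using fact_ge_self[of "Suc k"] less_exp[of "fact (Suc k)"]
    unfolding pow_fact_def by linarith
  then show "\<forall>\<^sub>F k in sequentially. k \<le> pow_fact (Suc k)"
    by simp
qed

lemma real_pow_fact_powr: "real (pow_fact k) powr x = 2 powr (fact k * x)"
  by (simp add: pow_fact_def powr_realpow[symmetric] powr_powr)

text \<open>The sum over \<open>S k\<close> is at most
  \<open>C * pow_fact k * pow_fact (Suc k) powr (g - s)\<close>. As \<open>g - s\<close> is a fixed
  negative number, the sparse scales eventually absorb the factor \<open>pow_fact k\<close> and
  leave geometric decay.\<close>

lemma summable_on_zeta:
  fixes S :: "nat \<Rightarrow> nat set"
  assumes fin: "\<And>k. finite (S k)" and range: "\<And>k. S k \<subseteq> {pow_fact (Suc k)..}"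
    and card: "\<And>k. real (card (S k)) \<le> C * real (pow_fact k) * real (pow_fact (Suc k)) powr g"
    and s: "g < s" "0 \<le> s" and C: "0 \<le> C"
  shows "(\<lambda>n. real n powr (- s)) summable_on (\<Union>k. S k)"
proof (rule summable_on_UN_nonneg[OF fin])
  let ?f = "\<lambda>n. real n powr (- s)"
  \<comment> \<open>From \<open>k0\<close> on, \<open>Suc k * (s - g)\<close> is at least 2: one
    copy of \<open>fact k\<close> cancels the factor \<open>pow_fact k\<close>, the other yields
    decay by \<open>2 powr (- fact k)\<close>.\<close>
  obtain k0 :: nat where k0: "2 / (s - g) \<le> real k0"
    using real_arch_simple by blast
  have "norm (sum ?f (S k)) \<le> C * (1 / 2) ^ k" if "k \<ge> k0" for k
  proof -
    have "2 / (s - g) \<le> real (Suc k)"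
      using k0 that by linarith
    then have "2 \<le> real (Suc k) * (s - g)"
      using s by (simp add: pos_divide_le_eq)
    then have "fact k * 2 \<le> fact k * (real (Suc k) * (s - g))"
      by (intro mult_left_mono) auto
    moreover have "real k \<le> fact k"
      using fact_ge_self[of k] by (metis of_nat_fact of_nat_le_iff)
    moreover have "(fact (Suc k) :: real) = fact k * real (Suc k)"
      by simp
    ultimately have expo: "fact k + fact (Suc k) * (g - s) \<le> - real k"
      by (simp add: algebra_simps del: fact_Suc)
    have "norm (sum ?f (S k)) = sum ?f (S k)"
      by (simp add: sum_nonneg)
    also have "\<dots> \<le> (\<Sum>n\<in>S k. real (pow_fact (Suc k)) powr (- s))"
    proof (rule sum_mono)
      fix n assume "n \<in> S k"
      then show "?f n \<le> real (pow_fact (Suc k)) powr (- s)"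
        using range[of k] s by (intro powr_mono2') auto
    qed
    also have "\<dots> = real (card (S k)) * real (pow_fact (Suc k)) powr (- s)"
      by simp
    also have "\<dots> \<le> C * real (pow_fact k) * real (pow_fact (Suc k)) powr g * real (pow_fact (Suc k)) powr (- s)"
      by (intro mult_right_mono card) simp
    also have "\<dots> = C * (real (pow_fact k) powr 1 * real (pow_fact (Suc k)) powr (g - s))"
      by (simp add: powr_add[symmetric] mult.assoc)
    also have "\<dots> = C * 2 powr (fact k + fact (Suc k) * (g - s))"
      unfolding real_pow_fact_powr powr_add by simp
    also have "\<dots> \<le> C * 2 powr (- real k)"
      by (intro mult_left_mono powr_mono expo C) simp
    also have "\<dots> = C * (1 / 2) ^ k"
      by (simp add: powr_minus powr_realpow power_one_over inverse_eq_divide)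
    finally show ?thesis .
  qed
  moreover have "summable (\<lambda>k. C * (1 / 2 :: real) ^ k)"
    by (intro summable_mult summable_geometric) simp
  ultimately show "summable (\<lambda>k. sum ?f (S k))"
    by (rule summable_comparison_test'[rotated])
qed simp

text \<open>The two bounds may come from different sets: the upper one counts all of
  \<open>S k\<close>, with slack \<open>pow_fact k\<close> for sums involving earlier scales, while
  the lower one counts only a convenient part \<open>T k\<close>.\<close>

lemma dim_zeta_UN_pow_fact:
  fixes S T :: "nat \<Rightarrow> nat set"
  assumes g: "0 \<le> g" and C: "0 \<le> C"
    and fin: "\<And>k. finite (S k)" and range: "\<And>k. S k \<subseteq> {pow_fact (Suc k)..}"
    and card: "\<And>k. real (card (S k)) \<le> C * real (pow_fact k) * real (pow_fact (Suc k)) powr g"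
    and T: "\<And>k. T k \<subseteq> S k" "\<And>k. T k \<subseteq> {..4 * pow_fact (Suc k)}"
      "\<And>k. real (pow_fact (Suc k)) powr g \<le> 4 * card (T k)"
  shows "dim_zeta (\<Union>k. S k) = g"
proof (rule dim_zeta_eqI[OF g])
  show "(\<lambda>n. real n powr (- s)) summable_on (\<Union>k. S k)" if "g < s" for s
    using that g C by (intro summable_on_zeta[OF fin range card]) auto
  show "\<not> (\<lambda>n. real n powr (- s)) summable_on (\<Union>k. S k)" if "0 \<le> s" "s < g" for s
  proof (rule not_summable_on_zeta[OF pow_fact_at_top _ _ T(3) that])
    show "T k \<subseteq> (\<Union>k. S k)" for k
      using T(1) by blast
    show "T k \<subseteq> {1..4 * pow_fact (Suc k)}" for k
      using T(1,2)[of k] range[of k] pow_fact_ge_1[of "Suc k"] by fastforce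
  qed
qed

section \<open>Sumsets of blocks\<close>

text \<open>Division with remainder by \<open>d\<close>: the quotient picks the term of the
  progression and the remainder, being below \<open>d \<le> b\<close>, is supplied by the
  interval.\<close>

lemma progression_plus_interval:
  fixes M a b d :: nat
  assumes "0 < d" "d \<le> b"
  shows "{2 * M..<2 * M + a * d} \<subseteq> (\<lambda>j. M + j * d) ` {..<a} + {M..<M + b}"
proof
  fix x assume x: "x \<in> {2 * M..<2 * M + a * d}"
  define t where "t = x - 2 * M"
  have t: "t < a * d" "x = 2 * M + t"
    using x by (auto simp: t_def)
  then have "t div d < a"
    using assms by (simp add: less_mult_imp_div_less)
  moreover have "t mod d < b"
    using assms mod_less_divisor[of d t] by linarith
  moreover have "x = (M + t div d * d) + (M + t mod d)"
    using t(2) by (simp add: algebra_simps)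
  ultimately show "x \<in> (\<lambda>j. M + j * d) ` {..<a} + {M..<M + b}"
    by (simp only:) (intro set_plus_intro image_eqI[OF refl]; simp)
qed

text \<open>This bounds the sumset by \<open>a * d + b\<close> elements; the product bound
  \<open>a * b\<close> would be too weak when \<gamma> < \<alpha> + \<beta>.\<close>

lemma progression_plus_interval_subset:
  fixes M a b d :: nat
  shows "(\<lambda>j. M + j * d) ` {..<a} + {M..<M + b} \<subseteq> {2 * M..<2 * M + (a * d + b)}"
proof
  fix x assume "x \<in> (\<lambda>j. M + j * d) ` {..<a} + {M..<M + b}"
  then obtain j y where "j < a" "y \<in> {M..<M + b}" "x = M + j * d + y"
    by (auto simp: set_plus_def)
  moreover from this have "j * d \<le> a * d"
    by (intro mult_right_mono) auto
  ultimately have "2 * M \<le> x" "x < 2 * M + (a * d + b)"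
    unfolding atLeastLessThan_iff by linarith+
  then show "x \<in> {2 * M..<2 * M + (a * d + b)}"
    by simp
qed

lemma card_set_plus_le:
  assumes "finite A" "finite B"
  shows "card (A + B) \<le> card A * card B"
proof -
  have "A + B = (\<lambda>(a, b). a + b) ` (A \<times> B)"
    by (auto simp: set_plus_def)
  then show ?thesis
    using card_image_le[of "A \<times> B"] assms by (simp add: card_cartesian_product)
qed

text \<open>A real number that is at least 1 loses at most a factor 2 when rounded down.\<close>

lemma nat_floor_powr_bounds:
  assumes "1 \<le> M" "0 \<le> p"
  shows "1 \<le> nat \<lfloor>real M powr p\<rfloor>" "real (nat \<lfloor>real M powr p\<rfloor>) \<le> real M powr p"
    "real M powr p \<le> 2 * real (nat \<lfloor>real M powr p\<rfloor>)"
proof -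
  have "1 \<le> real M powr p"
    using assms by (simp add: ge_one_powr_ge_zero)
  then have 1: "1 \<le> \<lfloor>real M powr p\<rfloor>"
    by simp
  then show "1 \<le> nat \<lfloor>real M powr p\<rfloor>" "real (nat \<lfloor>real M powr p\<rfloor>) \<le> real M powr p"
    by linarith+
  show "real M powr p \<le> 2 * real (nat \<lfloor>real M powr p\<rfloor>)"
    using 1 by linarith
qed

text \<open>Pairs of blocks are sorted by the larger index \<open>k\<close>, so that each piece lies
  above scale \<open>k\<close> and the other summand comes from the same or an earlier
  scale.\<close>

lemma set_plus_UN_split:
  fixes A B :: "nat \<Rightarrow> nat set"
  shows "(\<Union>k. A k) + (\<Union>k. B k)
    = (\<Union>k. (A k + B k) \<union> (A k + (\<Union>i<k. B i)) \<union> ((\<Union>i<k. A i) + B k))" (is "?L = ?R")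
proof
  show "?L \<subseteq> ?R"
  proof
    fix x assume "x \<in> ?L"
    then obtain i j a b where ab: "a \<in> A i" "b \<in> B j" "x = a + b"
      by (auto simp: set_plus_def)
    consider "i = j" | "i < j" | "j < i"
      by linarith
    then show "x \<in> ?R"
    proof cases
      case 1
      with ab have "x \<in> A i + B i"
        by (auto intro: set_plus_intro)
      then show ?thesis by blast
    next
      case 2
      with ab have "x \<in> (\<Union>i<j. A i) + B j"
        by (auto intro!: set_plus_intro)
      then show ?thesis by blast
    next
      case 3
      with ab have "x \<in> A i + (\<Union>j<i. B j)"
        by (auto intro!: set_plus_intro)
      then show ?thesis by blast
    qed
  qed
  show "?R \<subseteq> ?L"
    by (auto simp: set_plus_def)
qed

section \<open>Construction of the two sets\<close>

theorem theoremC2: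
  fixes \<alpha> \<beta> \<gamma> :: real
  assumes "\<alpha> \<in> {0..1}" and "\<beta> \<in> {0..1}" and "\<gamma> \<in> {0..1}"
    and "\<alpha> < \<beta>" and "\<beta> \<le> \<gamma>" and "\<gamma> \<le> min 1 (\<alpha> + \<beta>)"
  shows "\<exists>A B :: nat set. A \<subseteq> {0<..} \<and> B \<subseteq> {0<..} \<and>
    dim_zeta A = \<alpha> \<and> dim_zeta B = \<beta> \<and> dim_zeta (A + B) = \<gamma>"
proof -
  have ineqs: "0 \<le> \<alpha>" "\<alpha> \<le> 1" "0 \<le> \<beta>" "\<beta> \<le> 1" "0 \<le> \<gamma>" "\<gamma> \<le> 1"
    "\<alpha> \<le> \<gamma>" "\<beta> \<le> \<gamma>" "0 \<le> \<gamma> - \<alpha>" "\<gamma> - \<alpha> \<le> \<beta>"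
    using assms by auto
  \<comment> \<open>The shift by one makes \<open>pow_fact k\<close> an upper bound for every
    \<open>M i\<close> with \<open>i < k\<close>.\<close>
  define M where "M k = pow_fact (Suc k)" for k
  define a where "a k = nat \<lfloor>real (M k) powr \<alpha>\<rfloor>" for k
  define b where "b k = nat \<lfloor>real (M k) powr \<beta>\<rfloor>" for k
  \<comment> \<open>The exponent makes \<open>a k * d k\<close> about
    \<open>M k powr \<gamma>\<close>. It is nonnegative, and \<gamma> \<le> \<alpha> + \<beta> gives
    \<open>d k \<le> b k\<close>, so the interval fills the gaps of the progression.\<close>
  define d where "d k = nat \<lfloor>real (M k) powr (\<gamma> - \<alpha>)\<rfloor>" for k
  define A where "A k = (\<lambda>j. M k + j * d k) ` {..<a k}" for k
  define B where "B k = {M k..<M k + b k}" for k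

  have M1: "1 \<le> M k" for k
    unfolding M_def by (rule pow_fact_ge_1)
  note a = nat_floor_powr_bounds[OF M1 ineqs(1), folded a_def]
  note b = nat_floor_powr_bounds[OF M1 ineqs(3), folded b_def]
  note d = nat_floor_powr_bounds[OF M1 ineqs(9), folded d_def]
  have powr_le: "real (M k) powr p \<le> real (M k) powr q" if "p \<le> q" for p q k
    using that M1[of k] by (intro powr_mono) auto
  have db: "d k \<le> b k" for k
    unfolding d_def b_def by (intro nat_mono floor_mono powr_le ineqs)
  have powr_\<gamma>: "real (M k) powr \<alpha> * real (M k) powr (\<gamma> - \<alpha>) = real (M k) powr \<gamma>" for k
    by (simp add: powr_add[symmetric])
  have ad_le: "real (a k * d k) \<le> real (M k) powr \<gamma>" for k
    unfolding powr_\<gamma>[symmetric] of_nat_mult by (intro mult_mono a d) auto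
  \<comment> \<open>Each of the two roundings costs a factor 2.\<close>
  have ad_ge: "real (M k) powr \<gamma> \<le> 4 * real (a k * d k)" for k
  proof -
    have "real (M k) powr \<gamma> \<le> (2 * real (a k)) * (2 * real (d k))"
      unfolding powr_\<gamma>[symmetric] by (intro mult_mono a d) auto
    then show ?thesis by simp
  qed
  have le_M: "real (M k) powr p \<le> real (M k)" if "p \<le> 1" for p k
    using powr_le[OF that] by simp
  have adM: "a k * d k \<le> M k" and bM: "b k \<le> M k" for k
    using order_trans[OF ad_le[of k] le_M] order_trans[OF b(2)[of k] le_M] ineqs
    by (auto simp del: of_nat_mult)

  have A_range: "A k \<subseteq> {M k..2 * M k}" for k
  proof -
    have "j * d k \<le> M k" if "j < a k" for j
      using mult_right_mono[of j "a k" "d k"] that adM[of k] by linarith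
    then show ?thesis by (auto simp: A_def)
  qed
  have B_range: "B k \<subseteq> {M k..2 * M k}" for k
    using bM[of k] by (auto simp: B_def)
  have finA: "finite (A k)" and finB: "finite (B k)" for k
    by (simp_all add: A_def B_def)
  have cardA: "card (A k) = a k" for k
    unfolding A_def using d(1)[of k] by (subst card_image) (auto intro!: inj_onI)
  have cardB: "card (B k) = b k" for k
    by (simp add: B_def)

  \<comment> \<open>This brings bounds without the factor \<open>pow_fact k\<close> into the form
    required by \<open>dim_zeta_UN_pow_fact\<close>.\<close>
  have step: "x \<le> real (pow_fact k) * x" if "0 \<le> x" for x k
    using mult_right_mono[of 1 "real (pow_fact k)" x] that pow_fact_ge_1[of k] by simp

  have dimA: "dim_zeta (\<Union>k. A k) = \<alpha>"
  proof (rule dim_zeta_UN_pow_fact[where C = 1 and T = A])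
    show "real (card (A k)) \<le> 1 * real (pow_fact k) * real (pow_fact (Suc k)) powr \<alpha>" for k
      using order_trans[OF a(2)[of k] step[of _ k]] by (simp add: cardA M_def mult_ac)
    show "real (pow_fact (Suc k)) powr \<alpha> \<le> 4 * card (A k)" for k
      using a(3)[of k] by (simp add: cardA M_def)
  qed (use ineqs finA A_range in \<open>force simp: M_def\<close>)+
  have dimB: "dim_zeta (\<Union>k. B k) = \<beta>"
  proof (rule dim_zeta_UN_pow_fact[where C = 1 and T = B])
    show "real (card (B k)) \<le> 1 * real (pow_fact k) * real (pow_fact (Suc k)) powr \<beta>" for k
      using order_trans[OF b(2)[of k] step[of _ k]] by (simp add: cardB M_def mult_ac)
    show "real (pow_fact (Suc k)) powr \<beta> \<le> 4 * card (B k)" for k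
      using b(3)[of k] by (simp add: cardB M_def)
  qed (use ineqs finB B_range in \<open>force simp: M_def\<close>)+

  have small: "(\<Union>i<k. X i) \<subseteq> {..2 * pow_fact k}" if "\<And>i. X i \<subseteq> {M i..2 * M i}" for X k
  proof -
    have "M i \<le> pow_fact k" if "i < k" for i
      unfolding M_def using that by (intro pow_fact_mono) simp
    then show ?thesis
      using that by fastforce
  qed
  \<comment> \<open>The interval \<open>{..2 * pow_fact k}\<close> includes 0, and the extra element
    is absorbed by \<open>1 \<le> pow_fact k\<close>.\<close>
  have card_small: "card (\<Union>i<k. X i) \<le> 3 * pow_fact k" if "\<And>i. X i \<subseteq> {M i..2 * M i}" for X k
    using card_mono[OF _ small[OF that, of k]] pow_fact_ge_1[of k] by simp

  define S where "S k = (A k + B k) \<union> (A k + (\<Union>i<k. B i)) \<union> ((\<Union>i<k. A i) + B k)" for k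
  have AB: "A k + B k \<subseteq> {2 * M k..<2 * M k + (a k * d k + b k)}" for k
    unfolding A_def B_def by (rule progression_plus_interval_subset)
  have "dim_zeta (\<Union>k. S k) = \<gamma>"
  \<comment> \<open>The constant is 8 = 1 + 1 + 3 + 3: the terms \<open>a k * d k\<close> and
    \<open>b k\<close> from equal scales, and 3 for each of the two mixed sumsets. The witness
    \<open>T\<close> is the gap-free interval inside \<open>A k + B k\<close>.\<close>
  proof (rule dim_zeta_UN_pow_fact[where C = 8 and T = "\<lambda>k. {2 * M k..<2 * M k + a k * d k}"])
    show "finite (S k)" for k
      unfolding S_def by (auto intro!: finite_set_plus finA finB)
    show "S k \<subseteq> {pow_fact (Suc k)..}" for k
      using A_range[of k] B_range[of k] by (fastforce simp: S_def M_def set_plus_def)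
    show "real (card (S k)) \<le> 8 * real (pow_fact k) * real (pow_fact (Suc k)) powr \<gamma>" for k
    proof -
      have 1: "card (A k + B k) \<le> a k * d k + b k"
        using card_mono[OF _ AB[of k]] by simp
      have 2: "card (A k + (\<Union>i<k. B i)) \<le> a k * (3 * pow_fact k)"
        using card_set_plus_le[of "A k" "\<Union>i<k. B i"] card_small[of B k] B_range finA finB
        by (fastforce simp: cardA intro: order_trans mult_left_mono)
      have 3: "card ((\<Union>i<k. A i) + B k) \<le> (3 * pow_fact k) * b k"
        using card_set_plus_le[of "\<Union>i<k. A i" "B k"] card_small[of A k] A_range finA finB
        by (fastforce simp: cardB intro: order_trans mult_right_mono)
      have "card (S k) \<le> (a k * d k + b k) + a k * (3 * pow_fact k) + (3 * pow_fact k) * b k"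
        unfolding S_def
        by (intro order_trans[OF card_Un_le] add_mono 1 2 3)
      then have "real (card (S k))
          \<le> real ((a k * d k + b k) + a k * (3 * pow_fact k) + (3 * pow_fact k) * b k)"
        by (rule of_nat_mono)
      also have "\<dots> = real (a k * d k) + real (b k) + 3 * (real (pow_fact k) * real (a k)) + 3 * (real (pow_fact k) * real (b k))"
        by simp
      finally have "real (card (S k)) \<le> \<dots>" .
      \<comment> \<open>Here \<beta> \<le> \<gamma> keeps the mixed sums from raising the dimension
        above \<gamma>.\<close>
      moreover have "real (a k) \<le> real (M k) powr \<gamma>" "real (b k) \<le> real (M k) powr \<gamma>"
        using a(2)[of k] b(2)[of k] powr_le[of _ \<gamma> k] ineqs by (meson order_trans)+
      moreover from this have "real (pow_fact k) * real (a k) \<le> real (pow_fact k) * real (M k) powr \<gamma>"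
        "real (pow_fact k) * real (b k) \<le> real (pow_fact k) * real (M k) powr \<gamma>"
        by (auto intro: mult_left_mono)
      moreover have "real (M k) powr \<gamma> \<le> real (pow_fact k) * real (M k) powr \<gamma>"
        by (rule step) simp
      ultimately show ?thesis
        using ad_le[of k] unfolding M_def[symmetric] by linarith
    qed
    show "{2 * M k..<2 * M k + a k * d k} \<subseteq> S k" for k
      using progression_plus_interval[of "d k" "b k" "M k" "a k"] d(1)[of k] db[of k]
      unfolding S_def A_def[of k] B_def[of k] by auto
    show "{2 * M k..<2 * M k + a k * d k} \<subseteq> {..4 * pow_fact (Suc k)}" for k
      using adM[of k] by (auto simp: M_def)
    show "real (pow_fact (Suc k)) powr \<gamma> \<le> 4 * card {2 * M k..<2 * M k + a k * d k}" for k
      using ad_ge[of k] by (simp add: M_def)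
  qed (use ineqs in auto)
  then have dimAB: "dim_zeta ((\<Union>k. A k) + (\<Union>k. B k)) = \<gamma>"
    unfolding set_plus_UN_split S_def .
  have "{M k..2 * M k} \<subseteq> {0<..}" for k
    using M1[of k] by auto
  then have "(\<Union>k. A k) \<subseteq> {0<..}" "(\<Union>k. B k) \<subseteq> {0<..}"
    using A_range B_range by blast+
  with dimA dimB dimAB show ?thesis
    by blast
qed

end
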